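(* The Method of Fractional Equal Shares (FrES) satisfies Fractional EJR. That is, for every participatory budgeting election $(C,V,b)$ with arbitrary additive utilities $u_i : C \to \mathbb{R}_{\ge 0}$, every fractional outcome $W$ returned by FrES has the following property: for every $T \subseteq C$, $\beta : C \to [0,1]$, $\gamma : C \to \mathbb{R}_{\ge 0}$ and every nonempty group of voters $S \subseteq V$ that is $(T,\beta,\gamma)$-cohesive, there is a voter $v_i \in S$ with $$\sum_{c \in C} u_i(c)\cdot W_c \;\ge\; \sum_{c\in T}\gamma(c).$$
   Context: Election. A participatory budgeting election is a tuple $(C,V,b)$ with a finite set of candidates (projects) $C$, a finite nonempty set of voters $V=\{v_1,\dots,v_n\}$ and a budget $b>0$. Each $c\in C$ has a cost $\mathrm{cost}(c)\in(0,b]$, and each voter $v_i$ has a utility function $u_i : C\to\mathbb{R}_{\ge 0}$. In the fractional model an outcome is a vector $W=(W_c)_{c\in C}\in[0,1]^C$, where $W_c$ is the fraction of project $c$ that is funded; the utility of voter $v_i$ from $W$ is $\sum_{c\in C}u_i(c)W_c$. Fractional Equal Shares (FrES). Initially $W_c=0$ for all $c\in C$, $b_i=b/n$ for every voter $v_i$, and the set of active voters is $A=V$. While there is a candidate $c$ with $W_c\neq 1$ and $\sum_{v_i\in A}u_i(c)>0$, do the following: 1. Choose a candidate $c$ minimizing $\mathrm{cost}(c)/\sum_{v_i\in A}u_i(c)$ among the candidates with $W_c\ne 1$ (the ratio is $+\infty$ when the denominator is $0$; ties are broken arbitrarily), and let $\rho=\mathrm{cost}(c)/\sum_{v_i\in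 A}u_i(c)$. 2. Let $\alpha=\min\bigl(1-W_c,\ \min_{v_i\in A,\,u_i(c)>0} b_i/(\rho\, u_i(c))\bigr)$. 3. Set $W_c:=W_c+\alpha$, and for each $v_i\in A$ set $b_i:=b_i-\alpha\rho\, u_i(c)$; remove from $A$ every voter with $b_i=0$. FrES returns the final $W$ (no completion step is applied). Cohesiveness. A group $S\subseteq V$ is $(T,\beta,\gamma)$-cohesive, for $T\subseteq C$, $\beta:C\to[0,1]$, $\gamma:C\to\mathbb{R}_{\ge0}$, if (1) $\sum_{c\in T}\mathrm{cost}(c)\,\beta(c)\le b\cdot|S|/n$, and (2) $u_i(c)\,\beta(c)\ge\gamma(c)$ for all $c\in T$ and $v_i\in S$. *)

theory Defs
  imports Complex_Main "HOL-Library.Extended_Real"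
begin

record ('c, 'v) election =
  candidates :: "'c set"
  voters :: "'v set"
  budget :: real
  cost :: "'c \<Rightarrow> real"
  util :: "'v \<Rightarrow> 'c \<Rightarrow> real"

definition pb_election :: "('c, 'v) election \<Rightarrow> bool" where
  "pb_election E \<longleftrightarrow>
     finite (candidates E) \<and> finite (voters E) \<and> voters E \<noteq> {} \<and> budget E > 0 \<and>
     (\<forall>c\<in>candidates E. 0 < cost E c \<and> cost E c \<le> budget E) \<and>
     (\<forall>i\<in>voters E. \<forall>c\<in>candidates E. util E i c \<ge> 0)"

definition utility :: "('c, 'v) election \<Rightarrow> 'v \<Rightarrow> ('c \<Rightarrow> real) \<Rightarrow> real" where
  "utility E i W = (\<Sum>c\<in>candidates E. util E i c * W c)"

(* A state (W, m, A) of the method: funded fractions W, remaining money m i of each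
   voter i (b_i in the usual notation), and active voters A. *)
type_synonym ('c, 'v) fres_state = "('c \<Rightarrow> real) \<times> ('v \<Rightarrow> real) \<times> 'v set"

definition active_util :: "('c, 'v) election \<Rightarrow> 'v set \<Rightarrow> 'c \<Rightarrow> real" where
  "active_util E A c = (\<Sum>i\<in>A. util E i c)"

definition price :: "('c, 'v) election \<Rightarrow> 'v set \<Rightarrow> 'c \<Rightarrow> ereal" where
  "price E A c =
     (if active_util E A c = 0 then \<infinity> else ereal (cost E c / active_util E A c))"

definition fres_init :: "('c, 'v) election \<Rightarrow> ('c, 'v) fres_state" where
  "fres_init E = (\<lambda>_. 0, \<lambda>_. budget E / real (card (voters E)), voters E)"

definition fres_continues :: "('c, 'v) election \<Rightarrow> ('c, 'v) fres_state \<Rightarrow> bool" where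
  "fres_continues E = (\<lambda>(W, m, A). \<exists>c\<in>candidates E. W c \<noteq> 1 \<and> active_util E A c > 0)"

(* The step is a relation because ties between minimizers are broken arbitrarily.
   Whenever the loop continues, some price is finite, so the chosen c has positive
   active utility: rho is its price as a real number, and the inner minimum is taken
   over a nonempty set. *)
inductive fres_step ::
    "('c, 'v) election \<Rightarrow> ('c, 'v) fres_state \<Rightarrow> ('c, 'v) fres_state \<Rightarrow> bool"
  for E :: "('c, 'v) election" where
  "\<lbrakk> fres_continues E (W, m, A);
     is_arg_min (price E A) (\<lambda>c. c \<in> candidates E \<and> W c \<noteq> 1) c;
     \<rho> = cost E c / active_util E A c;
     \<alpha> = min (1 - W c) (Min ((\<lambda>i. m i / (\<rho> * util E i c)) ` {i\<in>A. util E i c > 0}));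
     W' = W(c := W c + \<alpha>);
     m' = (\<lambda>i. if i \<in> A then m i - \<alpha> * \<rho> * util E i c else m i);
     A' = {i\<in>A. m' i \<noteq> 0} \<rbrakk>
   \<Longrightarrow> fres_step E (W, m, A) (W', m', A')"

definition fres_outcome :: "('c, 'v) election \<Rightarrow> ('c \<Rightarrow> real) \<Rightarrow> bool" where
  "fres_outcome E W \<longleftrightarrow>
     (\<exists>m A. (fres_step E)\<^sup>*\<^sup>* (fres_init E) (W, m, A) \<and> \<not> fres_continues E (W, m, A))"

definition cohesive ::
    "('c, 'v) election \<Rightarrow> 'c set \<Rightarrow> ('c \<Rightarrow> real) \<Rightarrow> ('c \<Rightarrow> real) \<Rightarrow> 'v set \<Rightarrow> bool" where
  "cohesive E T \<beta> \<gamma> S \<longleftrightarrow>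
     (\<Sum>c\<in>T. cost E c * \<beta> c) \<le> budget E * real (card S) / real (card (voters E)) \<and>
     (\<forall>c\<in>T. \<forall>i\<in>S. util E i c * \<beta> c \<ge> \<gamma> c)"

definition fractional_EJR :: "('c, 'v) election \<Rightarrow> ('c \<Rightarrow> real) \<Rightarrow> bool" where
  "fractional_EJR E W \<longleftrightarrow>
     (\<forall>T \<beta> \<gamma> S.
        T \<subseteq> candidates E \<longrightarrow> S \<subseteq> voters E \<longrightarrow> S \<noteq> {} \<longrightarrow>
        (\<forall>c\<in>candidates E. 0 \<le> \<beta> c \<and> \<beta> c \<le> 1) \<longrightarrow>
        (\<forall>c\<in>candidates E. 0 \<le> \<gamma> c) \<longrightarrow>
        cohesive E T \<beta> \<gamma> S \<longrightarrow>
        (\<exists>i\<in>S. utility E i W \<ge> (\<Sum>c\<in>T. \<gamma> c)))"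

end

(* Up to the first moment when a voter of the cohesive group S runs out of money, all active
   voters pay the same price per unit of utility, so voter i has spent (sum over x of p x * u_i x)
   for prices p x that do not depend on i. Let r be the price at that moment and i the voter who
   then runs out of money. Prices never decrease, so p x <= r * W x; a project x of T that was not
   fully funded before this moment is not cheaper than r, and one that was fully funded satisfies
   p x * sum(u_j x | j in S) <= cost x. Either way
     r * W x * u_i x - p x * u_i x >= r * gamma x - cost x * beta x / |S|,
   and summing over x, with the spending of i equal to b/n, bounds the utility of i from below.
   If nobody in S ever runs out of money, everything S values is fully funded. *)
theory Submission imports Defs begin

section \<open>Basic facts on elections and monotonicity in voters and funding\<close>

locale pb =
  fixes E :: "('c, 'v) election"
  assumes pb: "pb_election E"
begin

lemma finite_candidates: "finite (candidates E)"
  and finite_voters: "finite (voters E)"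
  and card_voters_pos: "0 < card (voters E)"
  and cost_pos: "c \<in> candidates E \<Longrightarrow> 0 < cost E c"
  and util_nonneg: "i \<in> voters E \<Longrightarrow> c \<in> candidates E \<Longrightarrow> 0 \<le> util E i c"
  and budget_pos: "0 < budget E"
  using pb by (auto simp: pb_election_def card_gt_0_iff)

lemma active_util_mono:
  assumes "A \<subseteq> B" "B \<subseteq> voters E" "c \<in> candidates E"
  shows "active_util E A c \<le> active_util E B c"
  unfolding active_util_def
  using assms finite_voters by (intro sum_mono2) (auto intro: util_nonneg finite_subset)

lemma active_util_nonneg:
  assumes "A \<subseteq> voters E" "c \<in> candidates E"
  shows "0 \<le> active_util E A c"
  unfolding active_util_def using assms by (auto intro!: sum_nonneg util_nonneg)

lemma utility_mono:
  assumes "i \<in> voters E" "\<And>c. c \<in> candidates E \<Longrightarrow> W c \<le> W' c"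
  shows "utility E i W \<le> utility E i W'"
  unfolding utility_def using assms by (intro sum_mono mult_left_mono) (auto intro: util_nonneg)

section \<open>Payments at uniform rates per unit of utility\<close>

definition valid_state :: "('c, 'v) fres_state \<Rightarrow> bool" where
  "valid_state = (\<lambda>(W, m, A). A \<subseteq> voters E \<and> (\<forall>i\<in>A. 0 \<le> m i) \<and>
     (\<forall>c\<in>candidates E. 0 \<le> W c \<and> W c \<le> 1))"

text \<open>\<open>p c\<close> is the amount per unit of utility that each voter in \<open>A\<close> has paid for \<open>c\<close> in total.
  The set \<open>U\<close> of unfunded projects is a separate parameter because, in the middle of a step, the
  price bounds still hold for the projects that were unfunded before it.\<close>

definition uniform_payments ::
    "'c set \<Rightarrow> 'v set \<Rightarrow> ('c \<Rightarrow> real) \<Rightarrow> ('v \<Rightarrow> real) \<Rightarrow> ('c \<Rightarrow> real) \<Rightarrow> bool" where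
  "uniform_payments U A W m p \<longleftrightarrow>
     (\<forall>i\<in>A. budget E / real (card (voters E)) - m i = (\<Sum>c\<in>candidates E. p c * util E i c)) \<and>
     (\<forall>c\<in>candidates E. 0 \<le> p c) \<and>
     (\<forall>c\<in>candidates E. \<forall>x\<in>candidates E. x = c \<or> x \<in> U \<longrightarrow>
        p c * active_util E A x \<le> W c * cost E x)"

text \<open>Rates are nonnegative, so removing voters only lowers the left sides of the price
  bounds, and fewer unfunded projects mean fewer bounds.\<close>

lemma uniform_payments_subset:
  assumes "uniform_payments U A W m p" "A' \<subseteq> A" "U' \<subseteq> U" "A \<subseteq> voters E"
  shows "uniform_payments U' A' W m p"
  unfolding uniform_payments_def
proof (intro conjI ballI impI)
  fix c x assume *: "c \<in> candidates E" "x \<in> candidates E" "x = c \<or> x \<in> U'"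
  have "p c * active_util E A' x \<le> p c * active_util E A x"
    using assms * by (intro mult_left_mono active_util_mono) (auto simp: uniform_payments_def)
  also have "\<dots> \<le> W c * cost E x"
    using assms * by (auto simp: uniform_payments_def)
  finally show "p c * active_util E A' x \<le> W c * cost E x" .
qed (use assms in \<open>auto simp: uniform_payments_def\<close>)

section \<open>A single step of FrES\<close>

text \<open>While the loop continues, some unfunded project has finite price, so a minimizer cannot
  have price infinity. Minimality is restated as a product, which also covers projects
  \<open>x\<close> without active utility: there it reads \<open>0 \<le> cost E x\<close>.\<close>

lemma arg_min_price:
  assumes cont: "fres_continues E (W, m, A)" and A: "A \<subseteq> voters E"
    and argmin: "is_arg_min (price E A) (\<lambda>c. c \<in> candidates E \<and> W c \<noteq> 1) c"
  shows "c \<in> candidates E" "W c \<noteq> 1" "0 < active_util E A c"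
    and "\<And>x. x \<in> candidates E \<Longrightarrow> W x \<noteq> 1 \<Longrightarrow>
      cost E c / active_util E A c * active_util E A x \<le> cost E x"
proof -
  show c: "c \<in> candidates E" "W c \<noteq> 1"
    using argmin by (auto simp: is_arg_min_def)
  have le: "price E A c \<le> price E A x" if "x \<in> candidates E" "W x \<noteq> 1" for x
    using argmin that by (auto simp: is_arg_min_def not_less)
  obtain d where d: "d \<in> candidates E" "W d \<noteq> 1" "0 < active_util E A d"
    using cont by (auto simp: fres_continues_def)
  have "active_util E A c \<noteq> 0"
    using le[OF d(1,2)] d(3) by (auto simp: price_def split: if_splits)
  then show pos: "0 < active_util E A c"
    using active_util_nonneg[OF A c(1)] by simp
  fix x assume x: "x \<in> candidates E" "W x \<noteq> 1"
  show "cost E c / active_util E A c * active_util E A x \<le> cost E x"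
  proof (cases "active_util E A x = 0")
    case True
    then show ?thesis using cost_pos[OF x(1)] by simp
  next
    case False
    then have "0 < active_util E A x" using active_util_nonneg[OF A x(1)] by simp
    then show ?thesis using le[OF x] pos by (simp add: price_def field_simps)
  qed
qed

text \<open>A step charges each active voter the same rate for \<open>c\<close>, so payments stay
  uniform. They are described for the old active set and the old unfunded projects, so that a voter
  exhausted by this very step is still covered.\<close>

lemma fres_step_payments:
  assumes step: "fres_step E (W, m, A) (W', m', A')"
    and valid: "valid_state (W, m, A)"
    and pay: "uniform_payments {x. W x \<noteq> 1} A W m p"
  obtains c p' where "c \<in> candidates E" "W c \<noteq> 1" "0 < active_util E A c"
    "\<And>x. x \<in> candidates E \<Longrightarrow> W x \<noteq> 1 \<Longrightarrow>
      cost E c / active_util E A c * active_util E A x \<le> cost E x"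
    "uniform_payments {x. W x \<noteq> 1} A W' m' p'"
    "valid_state (W', m', A')"
    "\<And>x. x \<in> candidates E \<Longrightarrow> W x \<le> W' x"
    "\<And>x. x \<noteq> c \<Longrightarrow> W' x = W x"
    "A' = {i\<in>A. m' i \<noteq> 0}"
  using step
proof cases
  case (1 c \<rho> \<alpha>)
  have A: "A \<subseteq> voters E" and finA: "finite A"
    using valid finite_voters by (auto simp: valid_state_def intro: finite_subset)
  note c = arg_min_price[OF 1(1) A 1(2)]
  let ?P = "{i\<in>A. util E i c > 0}"
  have \<rho>: "0 < \<rho>"
    using c cost_pos by (simp add: \<open>\<rho> = _\<close>)
  have \<rho>_le: "\<rho> * active_util E A x \<le> cost E x"
    if "x \<in> candidates E" "W x \<noteq> 1" for x
    using c(4) that by (simp add: \<open>\<rho> = _\<close>)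
  \<comment> \<open>Bounds on \<open>Min\<close> require a nonempty set; the positive active utility
    of \<open>c\<close> provides a paying voter.\<close>
  have "?P \<noteq> {}"
  proof
    assume "?P = {}"
    then have "active_util E A c \<le> 0"
      unfolding active_util_def by (intro sum_nonpos) (auto simp: not_less)
    then show False using c(3) by simp
  qed
  then have "0 \<le> Min ((\<lambda>i. m i / (\<rho> * util E i c)) ` ?P)"
    using finA valid \<rho> by (subst Min_ge_iff) (auto simp: valid_state_def)
  then have \<alpha>_ge: "0 \<le> \<alpha>"
    using valid c(1) by (simp add: \<open>\<alpha> = _\<close> valid_state_def)
  have \<alpha>_le: "\<alpha> \<le> 1 - W c"
    by (simp add: \<open>\<alpha> = _\<close>)
  have m'_ge: "0 \<le> m' i" if i: "i \<in> A" for i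
  proof (cases "util E i c > 0")
    case True
    then have "\<alpha> \<le> m i / (\<rho> * util E i c)"
      using i finA by (simp add: \<open>\<alpha> = _\<close> min_le_iff_disj)
    then show ?thesis
      using True \<rho> i by (simp add: \<open>m' = _\<close> field_simps)
  next
    case False
    then have "util E i c = 0" using util_nonneg[of i c] i A c(1) by auto
    then show ?thesis using i valid by (simp add: \<open>m' = _\<close> valid_state_def)
  qed
  \<comment> \<open>Voter \<open>i\<close> in \<open>A\<close> pays
    \<open>\<alpha> * \<rho> * util E i c\<close>, so only the rate for \<open>c\<close> grows, by
    \<open>\<alpha> * \<rho>\<close>.\<close>
  define p' where "p' = p(c := p c + \<alpha> * \<rho>)"
  have sum_p': "(\<Sum>x\<in>candidates E. p' x * util E i x) =
      (\<Sum>x\<in>candidates E. p x * util E i x) + \<alpha> * \<rho> * util E i c" for i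
  proof -
    have "(\<Sum>x\<in>candidates E. p' x * util E i x) =
        (\<Sum>x\<in>candidates E. p x * util E i x + (if x = c then \<alpha> * \<rho> * util E i c else 0))"
      by (rule sum.cong) (auto simp: p'_def algebra_simps)
    then show ?thesis
      using c(1) finite_candidates by (simp add: sum.distrib)
  qed
  \<comment> \<open>For \<open>y = c\<close> the left side grows by
    \<open>\<alpha> * \<rho> * active_util E A x\<close> and the right side by
    \<open>\<alpha> * cost E x\<close>. Minimality of \<open>\<rho>\<close> compares the two, also
    for \<open>x = c\<close>, which was unfunded before the step.\<close>
  have bound: "p' y * active_util E A x \<le> W' y * cost E x"
    if yx: "y \<in> candidates E" "x \<in> candidates E" "x = y \<or> W x \<noteq> 1" for x y
  proof -
    have old: "p y * active_util E A x \<le> W y * cost E x"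
      using pay yx by (auto simp: uniform_payments_def)
    show ?thesis
    proof (cases "y = c")
      case True
      then have "\<rho> * active_util E A x \<le> cost E x"
        using yx c(2) \<rho>_le by auto
      then have "\<alpha> * (\<rho> * active_util E A x) \<le> \<alpha> * cost E x"
        using \<alpha>_ge by (intro mult_left_mono)
      then show ?thesis
        using old True by (simp add: p'_def \<open>W' = _\<close> algebra_simps)
    next
      case False
      then show ?thesis using old by (simp add: p'_def \<open>W' = _\<close>)
    qed
  qed
  show thesis
  proof (rule that)
    show "uniform_payments {x. W x \<noteq> 1} A W' m' p'"
      using pay bound \<alpha>_ge \<rho> unfolding uniform_payments_def sum_p'
      by (auto simp: \<open>m' = _\<close> p'_def)
    show "valid_state (W', m', A')"
      using valid m'_ge A \<alpha>_ge \<alpha>_le by (auto simp: valid_state_def \<open>A' = _\<close> \<open>W' = _\<close>)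
  qed (use c \<alpha>_ge 1 in auto)
qed

section \<open>The first exhausted voter of a cohesive group\<close>

text \<open>This concerns the step that exhausts \<open>i\<close> while all of \<open>S\<close> is
  active beforehand: \<open>W\<close> is the funding before it, \<open>W'\<close> and
  \<open>m'\<close> are the funding and money after it.\<close>

lemma first_exhausted_voter_utility:
  assumes S: "S \<subseteq> A" "S \<noteq> {}" and A: "A \<subseteq> voters E" and T: "T \<subseteq> candidates E"
    and \<beta>: "\<And>x. x \<in> candidates E \<Longrightarrow> 0 \<le> \<beta> x \<and> \<beta> x \<le> 1"
    and coh: "cohesive E T \<beta> \<gamma> S"
    and c: "c \<in> candidates E" "W c \<noteq> 1" "0 < active_util E A c"
    and cheapest: "\<And>x. x \<in> candidates E \<Longrightarrow> W x \<noteq> 1 \<Longrightarrow>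
      cost E c / active_util E A c * active_util E A x \<le> cost E x"
    and pay: "uniform_payments {x. W x \<noteq> 1} A W' m' p"
    and W': "\<And>x. x \<noteq> c \<Longrightarrow> W' x = W x"
    and i: "i \<in> S" "m' i = 0"
  shows "(\<Sum>x\<in>T. \<gamma> x) \<le> utility E i W'"
proof -
  define \<rho> where "\<rho> = cost E c / active_util E A c"
  define k where "k = real (card S)"
  have finS: "finite S" using S A finite_voters by (meson finite_subset)
  have k: "0 < k" using S finS by (simp add: k_def card_gt_0_iff)
  have \<rho>: "0 < \<rho>" using c cost_pos by (simp add: \<rho>_def)
  have u: "0 \<le> util E i x" if "x \<in> candidates E" for x
    using that util_nonneg i S A by blast
  \<comment> \<open>This is the price bound at the unfunded project \<open>c\<close>, divided by its
    active utility.\<close>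
  have p_le: "p x \<le> \<rho> * W' x" if "x \<in> candidates E" for x
    using pay that c by (auto simp: uniform_payments_def \<rho>_def field_simps)
  \<comment> \<open>Cohesiveness is summed over \<open>S\<close>. The rate \<open>r\<close> will be
    \<open>\<rho>\<close> for projects not fully funded before the step and \<open>p x\<close> for
    the others.\<close>
  have group: "r * (k * \<gamma> x) \<le> cost E x * \<beta> x"
    if x: "x \<in> T" and r: "0 \<le> r" "r * active_util E A x \<le> cost E x" for r x
  proof -
    have xC: "x \<in> candidates E" using x T by auto
    have "k * \<gamma> x = (\<Sum>j\<in>S. \<gamma> x)" by (simp add: k_def)
    also have "\<dots> \<le> (\<Sum>j\<in>S. util E j x * \<beta> x)"
      using coh x by (intro sum_mono) (auto simp: cohesive_def)
    also have "\<dots> = active_util E S x * \<beta> x"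
      by (simp add: active_util_def sum_distrib_right)
    also have "\<dots> \<le> active_util E A x * \<beta> x"
      using \<beta> xC S A by (intro mult_right_mono active_util_mono) auto
    finally have "r * (k * \<gamma> x) \<le> r * (active_util E A x * \<beta> x)"
      using r by (intro mult_left_mono)
    also have "\<dots> = (r * active_util E A x) * \<beta> x" by simp
    also have "\<dots> \<le> cost E x * \<beta> x"
      using r \<beta> xC by (intro mult_right_mono) auto
    finally show ?thesis .
  qed
  \<comment> \<open>The right side is what \<open>i\<close> saved on \<open>x\<close> compared with
    paying \<open>\<rho>\<close> per unit of utility. It is never negative, which settles projects
    outside \<open>T\<close> and those with \<open>W x \<noteq> 1\<close>, where the left side is at
    most 0.\<close>
  have surplus: "(if x \<in> T then \<rho> * \<gamma> x - cost E x * \<beta> x / k else 0)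
      \<le> \<rho> * (util E i x * W' x) - p x * util E i x" if x: "x \<in> candidates E" for x
  proof -
    have nonneg: "0 \<le> \<rho> * (util E i x * W' x) - p x * util E i x"
      using mult_right_mono[OF p_le u, OF x x] by (simp add: algebra_simps)
    consider "x \<notin> T" | "x \<in> T" "W x \<noteq> 1" | "x \<in> T" "W x = 1" by blast
    then show ?thesis
    proof cases
      case 1
      then show ?thesis using nonneg by simp
    next
      case 2
      have "\<rho> * (k * \<gamma> x) \<le> cost E x * \<beta> x"
        using 2 \<rho> cheapest[OF x] by (intro group) (auto simp: \<rho>_def)
      then have "\<rho> * \<gamma> x \<le> cost E x * \<beta> x / k" using k by (simp add: field_simps)
      then show ?thesis using 2 nonneg by simp
    next
      case 3
      \<comment> \<open>Since \<open>W c \<noteq> 1\<close>, the project \<open>x\<close> differs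
        from \<open>c\<close> and keeps its full funding.\<close>
      then have W'x: "W' x = 1" using W'[of x] c(2) by auto
      have "p x * (k * \<gamma> x) \<le> cost E x * \<beta> x"
        using 3 pay x W'x by (intro group) (auto simp: uniform_payments_def)
      then have 1: "p x * \<gamma> x \<le> cost E x * \<beta> x / k" using k by (simp add: field_simps)
      have "\<gamma> x \<le> util E i x * \<beta> x" using coh 3 i by (auto simp: cohesive_def)
      also have "\<dots> \<le> util E i x" using u[OF x] \<beta>[OF x] by (simp add: mult_left_le)
      \<comment> \<open>As \<open>util E i x - \<gamma> x\<close> is nonnegative, the saving on
        \<open>x\<close> is at least \<open>(\<rho> - p x) * \<gamma> x\<close>; the bound on
        \<open>p x * \<gamma> x\<close> then finishes the case.\<close>
      finally have "p x * (util E i x - \<gamma> x) \<le> \<rho> * (util E i x - \<gamma> x)"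
        using p_le[OF x] W'x by (intro mult_right_mono) auto
      then show ?thesis using 1 3 W'x by (simp add: algebra_simps)
    qed
  qed
  have "budget E / real (card (voters E)) - m' i = (\<Sum>x\<in>candidates E. p x * util E i x)"
    using pay i(1) S(1) unfolding uniform_payments_def by blast
  then have spent: "(\<Sum>x\<in>candidates E. p x * util E i x) = budget E / real (card (voters E))"
    using i(2) by simp
  have "\<rho> * (\<Sum>x\<in>T. \<gamma> x) - (\<Sum>x\<in>T. cost E x * \<beta> x) / k
      = (\<Sum>x\<in>T. \<rho> * \<gamma> x - cost E x * \<beta> x / k)"
    by (simp add: sum_subtractf sum_distrib_left sum_divide_distrib)
  also have "\<dots> = (\<Sum>x\<in>candidates E. if x \<in> T then \<rho> * \<gamma> x - cost E x * \<beta> x / k else 0)"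
    using T finite_candidates by (simp add: sum.If_cases Int_absorb1)
  also have "\<dots> \<le> (\<Sum>x\<in>candidates E. \<rho> * (util E i x * W' x) - p x * util E i x)"
    by (intro sum_mono surplus)
  also have "\<dots> = \<rho> * utility E i W' - budget E / real (card (voters E))"
    by (simp add: spent sum_subtractf sum_distrib_left utility_def)
  finally have "\<rho> * (\<Sum>x\<in>T. \<gamma> x) - (\<Sum>x\<in>T. cost E x * \<beta> x) / k
      \<le> \<rho> * utility E i W' - budget E / real (card (voters E))" .
  \<comment> \<open>By the cost condition of cohesiveness, the share of \<open>T\<close> per member
    of \<open>S\<close> is at most the initial money of \<open>i\<close>, all of which is
    spent.\<close>
  moreover have "(\<Sum>x\<in>T. cost E x * \<beta> x) / k \<le> budget E / real (card (voters E))"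
    using coh k by (simp add: cohesive_def k_def field_simps)
  ultimately have "\<rho> * (\<Sum>x\<in>T. \<gamma> x) \<le> \<rho> * utility E i W'" by linarith
  then show ?thesis using \<rho> by simp
qed

section \<open>The whole run and its final state\<close>

text \<open>The disjunction is what makes induction work: as soon as a member of \<open>S\<close> is
  exhausted, a satisfied member exists, and it stays satisfied because funding never
  decreases.\<close>

lemma fres_run_invariant:
  assumes S: "S \<subseteq> voters E" "S \<noteq> {}" and T: "T \<subseteq> candidates E"
    and \<beta>: "\<And>x. x \<in> candidates E \<Longrightarrow> 0 \<le> \<beta> x \<and> \<beta> x \<le> 1"
    and coh: "cohesive E T \<beta> \<gamma> S"
    and run: "(fres_step E)\<^sup>*\<^sup>* (fres_init E) (W, m, A)"
  shows "valid_state (W, m, A) \<and> (\<exists>p. uniform_payments {x. W x \<noteq> 1} A W m p) \<and>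
    (S \<subseteq> A \<or> (\<exists>i\<in>S. (\<Sum>x\<in>T. \<gamma> x) \<le> utility E i W))"
  using run
proof (induction "(W, m, A)" arbitrary: W m A rule: rtranclp_induct)
  case base
  then have eq: "W = (\<lambda>_. 0)" "m = (\<lambda>_. budget E / real (card (voters E)))" "A = voters E"
    by (auto simp: fres_init_def)
  \<comment> \<open>Nothing has been paid yet, so all rates are zero.\<close>
  have "uniform_payments {x. W x \<noteq> 1} A W m (\<lambda>_. 0)"
    by (auto simp: eq uniform_payments_def)
  then show ?case
    using budget_pos S by (auto simp: eq valid_state_def)
next
  case (step s W' m' A')
  obtain W m A where s: "s = (W, m, A)" by (cases s)
  from step.hyps(3)[OF s] obtain p
    where valid: "valid_state (W, m, A)"
      and pay: "uniform_payments {x. W x \<noteq> 1} A W m p"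
      and alt: "S \<subseteq> A \<or> (\<exists>i\<in>S. (\<Sum>x\<in>T. \<gamma> x) \<le> utility E i W)" by blast
  have A: "A \<subseteq> voters E" using valid by (simp add: valid_state_def)
  obtain c p' where
    c: "c \<in> candidates E" "W c \<noteq> 1" "0 < active_util E A c"
    and cheapest: "\<And>x. x \<in> candidates E \<Longrightarrow> W x \<noteq> 1 \<Longrightarrow>
      cost E c / active_util E A c * active_util E A x \<le> cost E x"
    and pay': "uniform_payments {x. W x \<noteq> 1} A W' m' p'"
    and valid': "valid_state (W', m', A')"
    and mono: "\<And>x. x \<in> candidates E \<Longrightarrow> W x \<le> W' x"
    and W': "\<And>x. x \<noteq> c \<Longrightarrow> W' x = W x"
    and A': "A' = {i\<in>A. m' i \<noteq> 0}"
    by (rule fres_step_payments[OF step.hyps(2)[unfolded s] valid pay]) (rule that)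
  have "{x. W' x \<noteq> 1} \<subseteq> {x. W x \<noteq> 1}" using c(2) W' by force
  then have "uniform_payments {x. W' x \<noteq> 1} A' W' m' p'"
    using A A' by (intro uniform_payments_subset[OF pay']) auto
  moreover have "S \<subseteq> A' \<or> (\<exists>i\<in>S. (\<Sum>x\<in>T. \<gamma> x) \<le> utility E i W')"
  proof (cases "S \<subseteq> A")
    case True
    show ?thesis
    proof (cases "S \<subseteq> A'")
      case False
      \<comment> \<open>This step exhausts the first members of \<open>S\<close>, and any one of
        them is a witness.\<close>
      then obtain i where "i \<in> S" "m' i = 0" using True A' by auto
      then show ?thesis
        using first_exhausted_voter_utility[OF True S(2) A T \<beta> coh c cheapest pay' W'] by blast
    qed simp
  next
    case False
    then obtain i where "i \<in> S" "(\<Sum>x\<in>T. \<gamma> x) \<le> utility E i W" using alt by blast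
    then show ?thesis using utility_mono[of i W W'] mono S by fastforce
  qed
  ultimately show ?case using valid' by blast
qed

text \<open>At termination a project that is not fully funded has no active utility, so the active
  voter \<open>i\<close> values it at 0 and cohesiveness forces \<open>\<gamma> x \<le> 0\<close>.
  On a fully funded one, \<open>\<beta> x \<le> 1\<close> gives
  \<open>\<gamma> x \<le> util E i x\<close>.\<close>

lemma all_active_utility:
  assumes final: "\<not> fres_continues E (W, m, A)"
    and A: "A \<subseteq> voters E" and i: "i \<in> S" "i \<in> A" and T: "T \<subseteq> candidates E"
    and \<beta>: "\<And>x. x \<in> candidates E \<Longrightarrow> 0 \<le> \<beta> x \<and> \<beta> x \<le> 1"
    and W: "\<And>x. x \<in> candidates E \<Longrightarrow> 0 \<le> W x"
    and coh: "cohesive E T \<beta> \<gamma> S"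
  shows "(\<Sum>x\<in>T. \<gamma> x) \<le> utility E i W"
proof -
  have u: "0 \<le> util E i x" if "x \<in> candidates E" for x
    using that util_nonneg i A by blast
  have "\<gamma> x \<le> util E i x * W x" if x: "x \<in> T" for x
  proof -
    have xC: "x \<in> candidates E" using x T by auto
    have \<gamma>: "\<gamma> x \<le> util E i x * \<beta> x" using coh x i by (auto simp: cohesive_def)
    show ?thesis
    proof (cases "W x = 1")
      case True
      then show ?thesis using \<gamma> u[OF xC] \<beta>[OF xC] mult_left_le[of "\<beta> x" "util E i x"] by auto
    next
      case False
      then have "active_util E A x \<le> 0"
        using final xC by (auto simp: fres_continues_def not_less)
      moreover have "util E i x \<le> active_util E A x"
        using active_util_mono[of "{i}" A x] i A xC by (simp add: active_util_def)
      ultimately have "util E i x = 0" using u[OF xC] by simp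
      then show ?thesis using \<gamma> by simp
    qed
  qed
  then have "(\<Sum>x\<in>T. \<gamma> x) \<le> (\<Sum>x\<in>T. util E i x * W x)" by (rule sum_mono)
  also have "\<dots> \<le> utility E i W"
    unfolding utility_def using T u W finite_candidates by (intro sum_mono2) auto
  finally show ?thesis .
qed

end

theorem theorem1:
  fixes E :: "('c, 'v) election" and W :: "'c \<Rightarrow> real"
  assumes "pb_election E"
    and "fres_outcome E W"
  shows "fractional_EJR E W"
proof -
  interpret pb E using assms(1) by unfold_locales
  obtain m A where run: "(fres_step E)\<^sup>*\<^sup>* (fres_init E) (W, m, A)"
    and final: "\<not> fres_continues E (W, m, A)"
    using assms(2) by (auto simp: fres_outcome_def)
  show ?thesis
    unfolding fractional_EJR_def
  proof (intro allI impI)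
    fix T \<beta> \<gamma> S
    assume T: "T \<subseteq> candidates E" and S: "S \<subseteq> voters E" "S \<noteq> {}"
      and \<beta>: "\<forall>c\<in>candidates E. 0 \<le> \<beta> c \<and> \<beta> c \<le> 1"
      and coh: "cohesive E T \<beta> \<gamma> S"
    have \<beta>': "\<And>x. x \<in> candidates E \<Longrightarrow> 0 \<le> \<beta> x \<and> \<beta> x \<le> 1" using \<beta> by blast
    note inv = fres_run_invariant[OF S T \<beta>' coh run]
    show "\<exists>i\<in>S. (\<Sum>c\<in>T. \<gamma> c) \<le> utility E i W"
    \<comment> \<open>If all of \<open>S\<close> is still active at the end, any member is a
      witness; otherwise the invariant has already supplied one.\<close>
    proof (cases "S \<subseteq> A")
      case True
      then obtain i where i: "i \<in> S" "i \<in> A" using S by blast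
      have "A \<subseteq> voters E" "\<And>x. x \<in> candidates E \<Longrightarrow> 0 \<le> W x"
        using inv by (auto simp: valid_state_def)
      then show ?thesis using all_active_utility[OF final _ i T \<beta>' _ coh] i by blast
    next
      case False
      then show ?thesis using inv by blast
    qed
  qed
qed

end
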